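(* Let $\mathbf{u_p} = \mathbf{u}(1^{\omega}, (EERR)^{\omega})$ be the binary generalized pseudostandard word with directive bi-sequence $(1^{\omega}, (EERR)^{\omega})$, and let $\mathcal{C}_{\mathbf{u_p}}(n)$ be the number of distinct factors of length $n$ of $\mathbf{u_p}$. Then $$\mathcal{C}_{\mathbf{u_p}}(n) > 4n \quad \text{for all } n \geq 10.$$
   Context: Words are over the alphabet $\{0,1\}$; $\varepsilon$ is the empty word. An antimorphism is a map $\vartheta:\{0,1\}^*\to\{0,1\}^*$ with $\vartheta(vw)=\vartheta(w)\vartheta(v)$. $R$ is the reversal antimorphism ($R(0)=0$, $R(1)=1$) and $E$ is the exchange antimorphism ($E(0)=1$, $E(1)=0$; i.e. $E(w)$ is the reversal of $w$ with letters $0$ and $1$ swapped). For $\vartheta\in\{E,R\}$, a finite word $w$ is a $\vartheta$-palindrome if $\vartheta(w)=w$, and the closure $w^{\vartheta}$ is the shortest $\vartheta$-palindrome having $w$ as a prefix. Given $\Delta=\delta_1\delta_2\ldots$ with $\delta_i\in\{0,1\}$ and $\Theta=\vartheta_1\vartheta_2\ldots$ with $\vartheta_i\in\{E,R\}$, the generalized pseudostandard word $\mathbf{u}(\Delta,\Theta)$ is the infinite word whose prefixes $w_n$ are given by $w_0=\varepsilon$ and $w_{n+1}=(w_n\delta_{n+1})^{\vartheta_{n+1}}$. For $\mathbf{u_p}$, $\delta_i=1$ for all $i$ and $\Theta$ is the periodic repetition of $E,E,R,R$; e.g. $w_1=10$, $w_2=1010$, $w_3=10101$, $w_4=1010110101$.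 A factor of an infinite word is a finite block of consecutive letters of it. *)

theory Defs
  imports "HOL-Library.Sublist" "HOL-Library.Stream"
begin

(* The letter 0 is False and the letter 1 is True; infinite words are streams. *)

type_synonym word = "bool list"

definition antimorphism :: "(word \<Rightarrow> word) \<Rightarrow> bool" where
  "antimorphism f \<longleftrightarrow> (\<forall>v w. f (v @ w) = f w @ f v)"

datatype involution = E | R

fun apply_inv :: "involution \<Rightarrow> word \<Rightarrow> word" where
  "apply_inv R w = rev w"
| "apply_inv E w = rev (map Not w)"

lemma antimorphism_apply_inv: "antimorphism (apply_inv \<theta>)"
  by (cases \<theta>) (simp_all add: antimorphism_def)

lemma apply_inv_letters:
  "apply_inv R [a] = [a]"
  "apply_inv E [a] = [\<not> a]"
  by simp_all

lemma length_apply_inv: "length (apply_inv \<theta> w) = length w"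
  by (cases \<theta>) simp_all

lemma apply_inv_apply_inv: "apply_inv \<theta> (apply_inv \<theta> w) = w"
  by (cases \<theta>) (simp_all add: rev_map comp_def)

definition pal :: "involution \<Rightarrow> word \<Rightarrow> bool" where
  "pal \<theta> w \<longleftrightarrow> apply_inv \<theta> w = w"

definition shortest_pal :: "involution \<Rightarrow> word \<Rightarrow> word \<Rightarrow> bool" where
  "shortest_pal \<theta> w v \<longleftrightarrow> pal \<theta> v \<and> prefix w v \<and>
     (\<forall>v'. pal \<theta> v' \<and> prefix w v' \<longrightarrow> length v \<le> length v')"

definition pal_closure :: "involution \<Rightarrow> word \<Rightarrow> word" where
  "pal_closure \<theta> w = (THE v. shortest_pal \<theta> w v)"

lemma ex1_shortest_pal: "\<exists>!v. shortest_pal \<theta> w v"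
proof -
  let ?P = "\<lambda>v. pal \<theta> v \<and> prefix w v"
  let ?d = "w @ apply_inv \<theta> w"
  have anti: "apply_inv \<theta> (x @ y) = apply_inv \<theta> y @ apply_inv \<theta> x" for x y
    using antimorphism_apply_inv by (simp add: antimorphism_def)
  have d: "?P ?d"
    by (simp add: pal_def anti apply_inv_apply_inv)
  then obtain v where v: "?P v" "\<And>v'. ?P v' \<Longrightarrow> length v \<le> length v'"
    using ex_has_least_nat[of ?P ?d length] by blast
  have key: "apply_inv \<theta> z = take (length v - length w) w"
    if "pal \<theta> (w @ z)" "length (w @ z) = length v" for z
  proof -
    have "length z \<le> length w"
      using that(2) v(2)[OF d] by (simp add: length_apply_inv)
    moreover have "apply_inv \<theta> z @ apply_inv \<theta> w = w @ z"
      using that(1) by (simp add: pal_def anti)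
    then have "take (length z) (apply_inv \<theta> z @ apply_inv \<theta> w) = take (length z) (w @ z)"
      by simp
    ultimately show ?thesis
      using that(2)[symmetric] by (simp add: length_apply_inv)
  qed
  have "v' = v" if v': "shortest_pal \<theta> w v'" for v'
  proof -
    have len: "length v' = length v"
      using v v' unfolding shortest_pal_def by (meson le_antisym)
    obtain z where z: "v = w @ z" using v(1) by (auto simp: prefix_def)
    obtain z' where z': "v' = w @ z'" using v' by (auto simp: prefix_def shortest_pal_def)
    have "apply_inv \<theta> z = apply_inv \<theta> z'"
      using key[of z] key[of z'] v(1) v' len z z' by (simp add: shortest_pal_def)
    then show ?thesis
      using z z' by (metis apply_inv_apply_inv)
  qed
  moreover have "shortest_pal \<theta> w v"
    using v by (simp add: shortest_pal_def)
  ultimately show ?thesis by blast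
qed

lemma shortest_pal_pal_closure: "shortest_pal \<theta> w (pal_closure \<theta> w)"
  unfolding pal_closure_def by (rule theI' [OF ex1_shortest_pal])

(* Streams are indexed from 0, so \<Delta> !! n and \<Theta> !! n are the bi-sequence
   entries with index n + 1 when that sequence is indexed from 1. *)
primrec pseudostandard_prefix :: "bool stream \<Rightarrow> involution stream \<Rightarrow> nat \<Rightarrow> word" where
  "pseudostandard_prefix \<Delta> \<Theta> 0 = []"
| "pseudostandard_prefix \<Delta> \<Theta> (Suc n) =
     pal_closure (\<Theta> !! n) (pseudostandard_prefix \<Delta> \<Theta> n @ [\<Delta> !! n])"

definition pseudostandard_word :: "bool stream \<Rightarrow> involution stream \<Rightarrow> bool stream" where
  "pseudostandard_word \<Delta> \<Theta> =
     (THE u. \<forall>n. stake (length (pseudostandard_prefix \<Delta> \<Theta> n)) u = pseudostandard_prefix \<Delta> \<Theta> n)"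

lemma prefix_pseudostandard_prefix_Suc:
  "prefix (pseudostandard_prefix \<Delta> \<Theta> n @ [\<Delta> !! n]) (pseudostandard_prefix \<Delta> \<Theta> (Suc n))"
  using shortest_pal_pal_closure by (simp add: shortest_pal_def)

lemma prefix_pseudostandard_prefix_mono:
  "m \<le> n \<Longrightarrow> prefix (pseudostandard_prefix \<Delta> \<Theta> m) (pseudostandard_prefix \<Delta> \<Theta> n)"
proof (induction n rule: dec_induct)
  case (step n)
  then show ?case
    using prefix_pseudostandard_prefix_Suc append_prefixD prefix_order.trans by blast
qed simp

lemma length_pseudostandard_prefix_ge: "n \<le> length (pseudostandard_prefix \<Delta> \<Theta> n)"
proof (induction n)
  case (Suc n)
  then show ?case
    using prefix_length_le[OF prefix_pseudostandard_prefix_Suc[of \<Delta> \<Theta> n]] by simp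
qed simp

lemma ex1_pseudostandard_word:
  "\<exists>!u. \<forall>n. stake (length (pseudostandard_prefix \<Delta> \<Theta> n)) u = pseudostandard_prefix \<Delta> \<Theta> n"
proof (rule ex1I)
  let ?w = "pseudostandard_prefix \<Delta> \<Theta>"
  let ?u = "smap (\<lambda>k. ?w (Suc k) ! k) nats"
  have len: "k < length (?w (Suc k))" for k
    using length_pseudostandard_prefix_ge[of "Suc k" \<Delta> \<Theta>] by simp
  have nth: "?w m ! k = ?w n ! k" if "k < length (?w m)" "k < length (?w n)" for m n k
    by (cases "m \<le> n")
      (metis that nat_le_linear nth_append prefix_def prefix_pseudostandard_prefix_mono)+
  show "\<forall>n. stake (length (?w n)) ?u = ?w n"
  proof (intro allI nth_equalityI)
    fix n k
    assume "k < length (stake (length (?w n)) ?u)"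
    then have k: "k < length (?w n)" by simp
    then have "stake (length (?w n)) ?u ! k = ?w (Suc k) ! k"
      by (simp del: pseudostandard_prefix.simps)
    also have "\<dots> = ?w n ! k" using nth[OF len k] .
    finally show "stake (length (?w n)) ?u ! k = ?w n ! k" .
  qed simp
  show "u = ?u" if u: "\<forall>n. stake (length (?w n)) u = ?w n" for u
  proof -
    have "u !! k = ?w (Suc k) ! k" for k
      using u len by (metis stake_nth)
    then have "?u = u"
      by (simp add: smap_alt del: pseudostandard_prefix.simps)
    then show ?thesis ..
  qed
qed

lemma stake_pseudostandard_word:
  "stake (length (pseudostandard_prefix \<Delta> \<Theta> n)) (pseudostandard_word \<Delta> \<Theta>) = pseudostandard_prefix \<Delta> \<Theta> n"
  using theI' [OF ex1_pseudostandard_word[of \<Delta> \<Theta>]] by (simp add: pseudostandard_word_def)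

definition factors :: "'a stream \<Rightarrow> nat \<Rightarrow> 'a list set" where
  "factors u n = {stake n (sdrop i u) | i. True}"

definition factor_complexity :: "'a stream \<Rightarrow> nat \<Rightarrow> nat" where
  "factor_complexity u n = card (factors u n)"

(* card is 0 on infinite sets; over a finite alphabet this default never applies *)
lemma finite_factors: "finite (factors (u :: 'a :: finite stream) n)"
proof (rule finite_subset)
  show "factors u n \<subseteq> {xs. set xs \<subseteq> UNIV \<and> length xs = n}"
    by (auto simp: factors_def)
qed (rule finite_lists_length_eq, simp)

definition u_p :: "bool stream" where
  "u_p = pseudostandard_word (sconst True) (cycle [E, E, R, R])"

end

theory Submission
  imports Defs
begin

text \<open>
Write \<open>w\<^sub>n\<close> for the \<open>n\<close>-th prefix and \<open>a\<close>, \<open>b\<close>, \<open>c\<close>, \<open>d\<close>, \<open>a'\<close> for the lengths of \<open>w\<^sub>n\<close> with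
\<open>n = 4k, \<dots>, 4k + 4\<close>. They satisfy \<open>b = 2a + 2\<close>, \<open>c = 2b - e\<close>, \<open>d = 2c - 3\<close> and \<open>a' = 2d - a\<close>, where \<open>e\<close> is the
value of \<open>c\<close> in the preceding block. This is proved together with the fact that the only palindromic
prefixes (of either type) followed by the letter 0 are 1 and 101: two palindromic prefixes of
lengths \<open>m < l \<le> 2m\<close> force a shorter one of length \<open>2m - l\<close> whose next letter is known, so a closure
that is too short, or an unexpected palindromic prefix, descends to a forbidden one.

Every prefix of the word is left special, and so is its complement. For every length \<open>n > 2\<close> there
is another complementary pair of left special factors, branching off from \<open>w\<^sub>m\<close> or its complement,
where \<open>m\<close> is odd and the length of \<open>w\<^sub>m\<close> is the largest below \<open>n\<close>. Hence the complexity
grows by at least 4 at each step, and it remains to count the factors of length 10.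
\<close>

section \<open>Palindromic prefixes\<close>

text \<open>Letters are Booleans, so \<open>s = True\<close> stands for \<open>E\<close> and \<open>s = False\<close> for \<open>R\<close>.\<close>

definition pal_prefix :: "(nat \<Rightarrow> bool) \<Rightarrow> bool \<Rightarrow> nat \<Rightarrow> bool" where
  "pal_prefix u s m \<longleftrightarrow> (\<forall>i<m. u i = (u (m - 1 - i) \<noteq> s))"

lemma pal_prefixD:
  assumes "pal_prefix u s m" "i + j + 1 = m"
  shows "u i = (u j \<noteq> s)"
proof -
  have "i < m" "m - 1 - i = j" using assms(2) by linarith+
  then show ?thesis using assms(1) unfolding pal_prefix_def by metis
qed

lemma pal_prefixI:
  assumes "\<And>i j. i + j + 1 = m \<Longrightarrow> u i = (u j \<noteq> s)"
  shows "pal_prefix u s m"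
  unfolding pal_prefix_def by (intro allI impI assms) linarith

lemma pal_iff_nth:
  "pal \<theta> w \<longleftrightarrow> (\<forall>i j. i + j + 1 = length w \<longrightarrow> w ! i = (w ! j \<noteq> (\<theta> = E)))"
proof -
  have nth: "apply_inv \<theta> w ! i = (w ! (length w - Suc i) \<noteq> (\<theta> = E))" if "i < length w" for i
    using that by (cases \<theta>) (simp_all add: rev_nth)
  have "pal \<theta> w \<longleftrightarrow> (\<forall>i<length w. w ! i = (w ! (length w - Suc i) \<noteq> (\<theta> = E)))"
    unfolding pal_def list_eq_iff_nth_eq by (auto simp: length_apply_inv nth)
  also have "\<dots> \<longleftrightarrow> (\<forall>i j. i + j + 1 = length w \<longrightarrow> w ! i = (w ! j \<noteq> (\<theta> = E)))"
    by (smt (verit) Suc_eq_plus1 add_Suc_right add_diff_cancel_left' less_add_Suc1 add_Suc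
        le_add_diff_inverse Suc_le_eq)
  finally show ?thesis .
qed

lemma pal_stake_iff: "pal \<theta> (stake m s) \<longleftrightarrow> pal_prefix ((!!) s) (\<theta> = E) m"
proof
  assume *: "pal \<theta> (stake m s)"
  show "pal_prefix ((!!) s) (\<theta> = E) m"
  proof (rule pal_prefixI)
    fix i j assume "i + j + 1 = m"
    moreover from this have "stake m s ! i = (stake m s ! j \<noteq> (\<theta> = E))"
      using * unfolding pal_iff_nth length_stake by blast
    ultimately show "s !! i = (s !! j \<noteq> (\<theta> = E))"
      by (simp add: stake_nth)
  qed
next
  assume *: "pal_prefix ((!!) s) (\<theta> = E) m"
  show "pal \<theta> (stake m s)"
    unfolding pal_iff_nth length_stake
  proof (intro allI impI)
    fix i j assume "i + j + 1 = m"
    then show "stake m s ! i = (stake m s ! j \<noteq> (\<theta> = E))"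
      using pal_prefixD[OF *, of i j] by (simp add: stake_nth)
  qed
qed

lemma pal_append_apply_inv:
  assumes "pal \<theta> y"
  shows "pal \<theta> (x @ y @ apply_inv \<theta> x)"
  using assms antimorphism_apply_inv[of \<theta>]
  by (simp add: pal_def antimorphism_def apply_inv_apply_inv)

lemma length_pal_closure_le:
  assumes "pal \<theta> y"
  shows "length (pal_closure \<theta> (x @ y)) \<le> 2 * length x + length y"
proof -
  have "length (pal_closure \<theta> (x @ y)) \<le> length (x @ y @ apply_inv \<theta> x)"
    using shortest_pal_pal_closure[of \<theta> "x @ y"] pal_append_apply_inv[OF assms, of x]
    unfolding shortest_pal_def by (metis append.assoc prefixI)
  then show ?thesis
    by (simp add: length_apply_inv)
qed

section \<open>The prefixes of \<open>u_p\<close> and bounds on their closures\<close>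

definition up :: "nat \<Rightarrow> bool" where
  "up = (!!) u_p"

abbreviation w_p :: "nat \<Rightarrow> word" where
  "w_p \<equiv> pseudostandard_prefix (sconst True) (cycle [E, E, R, R])"

definition len :: "nat \<Rightarrow> nat" where
  "len n = length (w_p n)"

text \<open>\<open>exch n\<close> is the type of the closure producing \<open>w\<^sub>n\<^sub>+\<^sub>1\<close> from \<open>w\<^sub>n\<close>.\<close>

definition exch :: "nat \<Rightarrow> bool" where
  "exch n \<longleftrightarrow> n mod 4 < 2"

lemma w_p_eq_stake: "w_p n = stake (len n) u_p"
  unfolding len_def u_p_def by (rule stake_pseudostandard_word[symmetric])

lemma cycle_snth: "xs \<noteq> [] \<Longrightarrow> cycle xs !! n = xs ! (n mod length xs)"
  using sdrop_simps(1)[of n "cycle xs"]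
  by (simp add: sdrop_cycle hd_rotate_conv_nth del: sdrop_simps)

lemma cycle_exch: "(cycle [E, E, R, R] !! n = E) = exch n"
proof -
  have "n mod 4 = 0 \<or> n mod 4 = 1 \<or> n mod 4 = 2 \<or> n mod 4 = 3" by presburger
  then show ?thesis
    by (auto simp: cycle_snth exch_def simp del: cycle.simps)
qed

lemma len_less_Suc: "len n < len (Suc n)"
  using prefix_length_le[OF prefix_pseudostandard_prefix_Suc[of "sconst True" "cycle [E, E, R, R]" n]]
  by (simp add: len_def del: pseudostandard_prefix.simps)

lemma w_p_snoc: "w_p n @ [True] = stake (Suc (len n)) u_p"
proof -
  have "prefix (w_p n @ [True]) (stake (len (Suc n)) u_p)"
    using prefix_pseudostandard_prefix_Suc[of "sconst True" _ n]
    by (simp add: w_p_eq_stake[symmetric] del: pseudostandard_prefix.simps)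
  then have "w_p n @ [True] = take (Suc (len n)) (stake (len (Suc n)) u_p)"
    by (auto simp: prefix_def len_def)
  also have "\<dots> = stake (Suc (len n)) u_p"
    using len_less_Suc[of n] by (simp add: take_stake min_def)
  finally show ?thesis .
qed

lemma up_len: "up (len n)"
  using arg_cong[OF w_p_snoc[of n], of "\<lambda>w. w ! len n"]
  by (simp add: nth_append len_def[symmetric] up_def stake_nth del: stake.simps)

lemma w_p_Suc: "w_p (Suc n) = pal_closure (cycle [E, E, R, R] !! n) (stake (Suc (len n)) u_p)"
  unfolding w_p_snoc[symmetric] by simp

lemma pal_prefix_len: "pal_prefix up (exch n) (len (Suc n))"
proof -
  have "pal (cycle [E, E, R, R] !! n) (w_p (Suc n))"
    unfolding w_p_Suc by (metis shortest_pal_pal_closure shortest_pal_def)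
  then show ?thesis
    by (simp add: w_p_eq_stake pal_stake_iff cycle_exch up_def del: pseudostandard_prefix.simps)
qed

text \<open>All words involved are prefixes of \<open>u_p\<close>, so a palindromic prefix longer
  than \<open>w_p n\<close> automatically extends \<open>w_p n @ [True]\<close> and competes with
  the closure.\<close>

lemma len_minimal:
  assumes "pal_prefix up (exch n) m" "len n < m"
  shows "len (Suc n) \<le> m"
proof -
  have "pal (cycle [E, E, R, R] !! n) (stake m u_p)"
    using assms(1) by (simp add: pal_stake_iff cycle_exch up_def)
  moreover have "prefix (stake (Suc (len n)) u_p) (stake m u_p)"
    by (metis assms(2) Suc_leI le_Suc_ex stake_add prefixI)
  ultimately show ?thesis
    using shortest_pal_pal_closure[of "cycle [E, E, R, R] !! n" "stake (Suc (len n)) u_p"]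
    unfolding w_p_Suc[symmetric] w_p_eq_stake[of "Suc n"] shortest_pal_def
    by (metis length_stake)
qed

text \<open>The second assumption makes the suffix of \<open>w_p n @ [True]\<close> from position
  \<open>j\<close> on a palindrome; reflecting the \<open>j\<close> letters before it across that
  suffix gives a candidate for the closure.\<close>

lemma len_Suc_le:
  assumes "j \<le> Suc (len n)"
    and "\<And>i i'. j \<le> i \<Longrightarrow> j \<le> i' \<Longrightarrow> i + i' = j + len n \<Longrightarrow> up i = (up i' \<noteq> exch n)"
  shows "len (Suc n) \<le> Suc (len n) + j"
proof -
  let ?t = "cycle [E, E, R, R] !! n"
  let ?y = "stake (Suc (len n) - j) (sdrop j u_p)"
  have st: "stake (Suc (len n)) u_p = stake j u_p @ ?y"
    using assms(1) by (metis le_add_diff_inverse stake_add)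
  have "pal_prefix ((!!) (sdrop j u_p)) (exch n) (Suc (len n) - j)"
  proof (rule pal_prefixI)
    fix i i' assume "i + i' + 1 = Suc (len n) - j"
    then have "up (j + i) = (up (j + i') \<noteq> exch n)"
      by (intro assms(2)) auto
    then show "sdrop j u_p !! i = (sdrop j u_p !! i' \<noteq> exch n)"
      by (simp add: sdrop_snth up_def add.commute)
  qed
  then have "pal ?t ?y"
    by (simp add: pal_stake_iff cycle_exch del: cycle.simps stake.simps)
  then have "length (pal_closure ?t (stake j u_p @ ?y)) \<le> 2 * length (stake j u_p) + length ?y"
    by (rule length_pal_closure_le)
  then show ?thesis
    unfolding st[symmetric] w_p_Suc[symmetric] len_def[symmetric] length_stake
    using assms(1) by linarith
qed

section \<open>Lengths of the prefixes\<close>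

text \<open>Reflecting in the prefix of length \<open>c\<close>, then \<open>l\<close>, then
  \<open>c\<close> again sends i to 2c - l - 1 - i; the two reflections of type \<open>s\<close>
  cancel and type \<open>t\<close> remains. The first two reflections carry position 2c - l to
  \<open>c\<close>, which fixes the letter there.\<close>

lemma pal_prefix_border:
  assumes "pal_prefix u s c" "pal_prefix u t l" "c < l" "l \<le> 2 * c"
  shows "pal_prefix u t (2 * c - l)" "u (2 * c - l) = (u c = (s = t))"
proof -
  show "pal_prefix u t (2 * c - l)"
  proof (rule pal_prefixI)
    fix i j assume ij: "i + j + 1 = 2 * c - l"
    have "u j = (u (i + (l - c)) \<noteq> s)"
      by (rule pal_prefixD[OF assms(1)]) (use assms(3,4) ij in simp)
    moreover have "u (i + (l - c)) = (u (c - 1 - i) \<noteq> t)"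
      by (rule pal_prefixD[OF assms(2)]) (use assms(3,4) ij in simp)
    moreover have "u (c - 1 - i) = (u i \<noteq> s)"
      by (rule pal_prefixD[OF assms(1)]) (use assms(3,4) ij in simp)
    ultimately show "u i = (u j \<noteq> t)" by blast
  qed
  have "u (2 * c - l) = (u (l - 1 - c) \<noteq> s)"
    by (rule pal_prefixD[OF assms(1)]) (use assms(3,4) in simp)
  moreover have "u (l - 1 - c) = (u c \<noteq> t)"
    by (rule pal_prefixD[OF assms(2)]) (use assms(3,4) in simp)
  ultimately show "u (2 * c - l) = (u c = (s = t))" by blast
qed

text \<open>In odd length the middle letter would be its own complement.\<close>

lemma even_pal_prefix_E: "pal_prefix u True m \<Longrightarrow> even m"
  using pal_prefixD[of u True m "m div 2" "m div 2"] by presburger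

text \<open>
The exceptions 1 and 101 are palindromic prefixes that the directive bi-sequence misses: it is not
normalized.
\<close>

definition followed_by_1 :: "nat \<Rightarrow> bool" where
  "followed_by_1 N \<longleftrightarrow> (\<forall>m<N. \<forall>s. pal_prefix up s m \<longrightarrow> up m \<or> \<not> s \<and> (m = 1 \<or> m = 3))"

lemma followed_by_1D:
  "followed_by_1 N \<Longrightarrow> m < N \<Longrightarrow> pal_prefix up s m \<Longrightarrow> \<not> up m \<Longrightarrow> \<not> s \<and> (m = 1 \<or> m = 3)"
  unfolding followed_by_1_def by blast

lemma followed_by_1_extend:
  assumes "followed_by_1 (len n)"
    and "\<And>m s. len n < m \<Longrightarrow> m < N \<Longrightarrow> pal_prefix up s m \<Longrightarrow> \<not> s \<and> (m = 1 \<or> m = 3)"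
  shows "followed_by_1 N"
  unfolding followed_by_1_def
proof (intro allI impI)
  fix m s assume m: "m < N" "pal_prefix up s m"
  consider "m < len n" | "m = len n" | "len n < m" by linarith
  then show "up m \<or> \<not> s \<and> (m = 1 \<or> m = 3)"
  proof cases
    case 1 then show ?thesis using assms(1) m(2) unfolding followed_by_1_def by blast
  next
    case 2 then show ?thesis using up_len by simp
  next
    case 3 then show ?thesis using assms(2) m by blast
  qed
qed

text \<open>A closure of length at most \<open>2 * len n\<close> would leave an E-palindromic prefix
  followed by 0, and no exception has type \<open>E\<close>.\<close>

lemma len_Suc_RE:
  assumes "exch n" "pal_prefix up False (len n)" "followed_by_1 (len n)"
  shows "len (Suc n) = 2 * len n + 2"
proof (rule antisym)
  \<comment> \<open>Position \<open>Suc (len n)\<close> gives the empty suffix, so there is no pair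
    of letters to compare.\<close>
  show "len (Suc n) \<le> 2 * len n + 2"
    using len_Suc_le[of "Suc (len n)" n] by simp
  let ?l = "len (Suc n)"
  have l: "pal_prefix up True ?l" "len n < ?l"
    using pal_prefix_len[of n] assms(1) len_less_Suc by auto
  have "\<not> ?l \<le> 2 * len n"
  proof
    assume "?l \<le> 2 * len n"
    note b = pal_prefix_border[OF assms(2) l this]
    then have "\<not> up (2 * len n - ?l)" using up_len by blast
    moreover have "2 * len n - ?l < len n" using l(2) \<open>?l \<le> 2 * len n\<close> by linarith
    ultimately show False
      using followed_by_1D[OF assms(3) _ b(1)] by blast
  qed
  then show "2 * len n + 2 \<le> ?l"
    using even_pal_prefix_E[OF l(1)] by presburger
qed

text \<open>The E-palindrome starts, hence also ends, with 1010. With the new 1 it has the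
  R-palindromic suffix 10101, and 2(len n - 4) + 5 = 2 len n - 3. A shorter closure would leave an
  R-palindromic prefix longer than 101 and followed by 0.\<close>

lemma len_Suc_ER:
  assumes "\<not> exch n" "pal_prefix up True (len n)" "followed_by_1 (len n)" "4 \<le> len n"
    and "up 0" "\<not> up 1" "up 2" "\<not> up 3"
  shows "len (Suc n) = 2 * len n - 3"
proof (rule antisym)
  obtain r where r: "len n = r + 4" using assms(4) by (metis le_add_diff_inverse2)
  have "up (r + 3) = (up 0 \<noteq> True)" "up (r + 2) = (up 1 \<noteq> True)"
    "up (r + 1) = (up 2 \<noteq> True)" "up r = (up 3 \<noteq> True)"
    by (rule pal_prefixD[OF assms(2)]; simp add: r)+
  then have *: "\<not> up (r + 3)" "up (r + 2)" "\<not> up (r + 1)" "up r" "up (r + 4)"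
    using assms(5-8) up_len[of n] r by auto
  have "up i = (up i' \<noteq> exch n)"
    if "len n - 4 \<le> i" "len n - 4 \<le> i'" "i + i' = len n - 4 + len n" for i i'
  proof -
    have "r \<le> i" "r \<le> i'" "i + i' = 2 * r + 4" using that r by auto
    then consider "i = r" "i' = r + 4" | "i = r + 1" "i' = r + 3" | "i = r + 2" "i' = r + 2"
      | "i = r + 3" "i' = r + 1" | "i = r + 4" "i' = r" by linarith
    then show ?thesis using * assms(1) by cases (simp_all only: not_False_eq_True not_True_eq_False simp_thms)
  qed
  then have "len (Suc n) \<le> Suc (len n) + (len n - 4)"
    by (rule len_Suc_le[of "len n - 4" n, rotated]) simp_all
  then show "len (Suc n) \<le> 2 * len n - 3"
    using assms(4) by linarith
  let ?l = "len (Suc n)"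
  have l: "pal_prefix up False ?l" "len n < ?l"
    using pal_prefix_len[of n] assms(1) len_less_Suc by auto
  show "2 * len n - 3 \<le> ?l"
  proof (rule ccontr)
    assume "\<not> 2 * len n - 3 \<le> ?l"
    then have q: "?l \<le> 2 * len n" "2 * len n - ?l > 3" by auto
    note b = pal_prefix_border[OF assms(2) l this(1)]
    then have "\<not> up (2 * len n - ?l)" using up_len by blast
    moreover have "2 * len n - ?l < len n" using l(2) q by linarith
    ultimately have "2 * len n - ?l = 1 \<or> 2 * len n - ?l = 3"
      using followed_by_1D[OF assms(3) _ b(1)] by blast
    then show False using q(2) by linarith
  qed
qed

text \<open>The prefix of length \<open>e\<close> also ends \<open>w_p n\<close>, preceded by the
  image of 1, so the new 1 completes a palindromic suffix of length e + 2. Since the types agree, a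
  shorter closure would leave a palindromic prefix longer than \<open>e\<close> and followed by
  1.\<close>

lemma len_Suc_same:
  assumes "pal_prefix up (exch n) (len n)" "pal_prefix up (exch n) e" "up e" "e < len n"
    and "\<And>m. e < m \<Longrightarrow> m < len n \<Longrightarrow> pal_prefix up (exch n) m \<Longrightarrow> \<not> up m"
  shows "len (Suc n) = 2 * len n - e"
proof (rule antisym)
  let ?j = "len n - e - 1"
  have j: "up ?j = (up e \<noteq> exch n)"
    by (rule pal_prefixD[OF assms(1)]) (use assms(4) in simp)
  have "up i = (up i' \<noteq> exch n)"
    if i: "?j \<le> i" "?j \<le> i'" "i + i' = ?j + len n" for i i'
  proof -
    consider "i = len n \<and> i' = ?j" | "i' = len n \<and> i = ?j" | "i < len n" "i' < len n"
      using i by linarith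
    then show ?thesis
    proof cases
      case 3
      have "up i = (up (len n - 1 - i) \<noteq> exch n)" "up i' = (up (len n - 1 - i') \<noteq> exch n)"
        by (rule pal_prefixD[OF assms(1)]; use 3 in simp)+
      moreover have "up (len n - 1 - i) = (up (len n - 1 - i') \<noteq> exch n)"
        by (rule pal_prefixD[OF assms(2)]) (use 3 i assms(4) in simp)
      ultimately show ?thesis by blast
    qed (use j assms(3) up_len in auto)
  qed
  then have "len (Suc n) \<le> Suc (len n) + ?j"
    by (rule len_Suc_le[of ?j n, rotated]) simp_all
  then show "len (Suc n) \<le> 2 * len n - e"
    using assms(4) by linarith
  let ?l = "len (Suc n)"
  have l: "pal_prefix up (exch n) ?l" "len n < ?l"
    using pal_prefix_len[of n] len_less_Suc by auto
  show "2 * len n - e \<le> ?l"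
  proof (rule ccontr)
    assume "\<not> 2 * len n - e \<le> ?l"
    then have q: "?l \<le> 2 * len n" "2 * len n - ?l > e" by auto
    note b = pal_prefix_border[OF assms(1) l this(1)]
    then have "up (2 * len n - ?l)" using up_len by blast
    then show False
      using assms(5)[OF q(2) _ b(1)] l(2) q by auto
  qed
qed

text \<open>Beyond length \<open>len n + 2\<close>, reflecting in the prefixes of lengths
  \<open>m\<close>, \<open>len (Suc n)\<close> and \<open>len n\<close> leaves an E-palindromic
  prefix followed by 0. The two shorter lengths contradict the initial letters, except for length 1
  when \<open>w_p n\<close> is empty.\<close>

lemma no_pal_prefix_RE:
  assumes "pal_prefix up False (len n)" "followed_by_1 (len n)" "len (Suc n) = 2 * len n + 2" "exch n"
    and "up 0" "len n = 0 \<or> 1 < len n \<and> \<not> up 1"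
    and m: "len n < m" "m < len (Suc n)" "pal_prefix up False m"
  shows "m = 1"
proof -
  let ?a = "len n"
  have E: "pal_prefix up True (2 * ?a + 2)"
    using pal_prefix_len[of n] assms(3,4) by simp
  have next1: "\<not> up (?a + 1)"
    using pal_prefixD[OF E, of ?a "?a + 1"] up_len[of n] by simp
  consider "m = ?a + 1" | "m = ?a + 2" | "?a + 2 < m" using m(1) by linarith
  then show ?thesis
  proof cases
    case 1
    show ?thesis
    proof (cases "?a = 0")
      case False
      then have a: "1 < ?a" "\<not> up 1" using assms(6) by auto
      have "up 1 = (up (?a - 1) \<noteq> False)"
        by (rule pal_prefixD[OF m(3)]) (use 1 a in simp)
      moreover have "up 0 = (up (?a - 1) \<noteq> False)"
        by (rule pal_prefixD[OF assms(1)]) (use a in simp)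
      ultimately show ?thesis using a assms(5) by simp
    qed (use 1 in simp)
  next
    case 2
    then show ?thesis
      using pal_prefixD[OF m(3), of 0 "?a + 1"] next1 assms(5) by simp
  next
    case 3
    define j where "j = m - ?a - 2"
    have j: "j < ?a" "m = ?a + 2 + j" using 3 m(2) assms(3) by (auto simp: j_def)
    have "pal_prefix up True j"
    proof (rule pal_prefixI)
      fix i i' assume i: "i + i' + 1 = j"
      have "up i = (up (?a + 2 + i') \<noteq> False)"
        by (rule pal_prefixD[OF m(3)]) (use i j in simp)
      moreover have "up (?a + 2 + i') = (up (?a - 1 - i') \<noteq> True)"
        by (rule pal_prefixD[OF E]) (use i j in simp)
      moreover have "up (?a - 1 - i') = (up i' \<noteq> False)"
        by (rule pal_prefixD[OF assms(1)]) (use i j in simp)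
      ultimately show "up i = (up i' \<noteq> True)" by blast
    qed
    moreover have "up j = (up (?a + 1) \<noteq> False)"
      by (rule pal_prefixD[OF m(3)]) (use j in simp)
    ultimately show ?thesis
      using followed_by_1D[OF assms(2) j(1)] next1 by blast
  qed
qed

text \<open>The three reflections now leave an R-palindromic prefix of length
  \<open>m - len n + 3\<close>, longer than 101; the letter after it is the one at position 3, which
  is 0.\<close>

lemma no_pal_prefix_ER:
  assumes "pal_prefix up True (len n)" "followed_by_1 (len n)" "len (Suc n) = 2 * len n - 3" "\<not> exch n"
    and "4 \<le> len n" "\<not> up 3"
    and m: "len n < m" "m < len (Suc n)"
  shows "\<not> pal_prefix up True m"
proof
  assume mE: "pal_prefix up True m"
  let ?c = "len n"
  have R: "pal_prefix up False (2 * ?c - 3)"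
    using pal_prefix_len[of n] assms(3,4) by simp
  define q where "q = m - ?c + 3"
  have q: "3 < q" "q < ?c" "m = ?c + q - 3" using m assms(3,5) by (auto simp: q_def)
  have "pal_prefix up False q"
  proof (rule pal_prefixI)
    fix i i' assume i: "i + i' + 1 = q"
    have "up i = (up (?c - 3 + i') \<noteq> True)"
      by (rule pal_prefixD[OF mE]) (use i q in simp)
    moreover have "up (?c - 3 + i') = (up (?c - 1 - i') \<noteq> False)"
      by (rule pal_prefixD[OF R]) (use i q in simp)
    moreover have "up (?c - 1 - i') = (up i' \<noteq> True)"
      by (rule pal_prefixD[OF assms(1)]) (use i q in simp)
    ultimately show "up i = (up i' \<noteq> False)" by blast
  qed
  moreover have "up q = (up (?c - 4) \<noteq> True)"
    by (rule pal_prefixD[OF mE]) (use q in simp)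
  moreover have "up (?c - 4) = (up 3 \<noteq> True)"
    by (rule pal_prefixD[OF assms(1)]) (use assms(5) in simp)
  ultimately show False
    using followed_by_1D[OF assms(2) q(2)] assms(6) q(1) by auto
qed

text \<open>The border of \<open>m\<close> inside \<open>len (Suc n)\<close> has length
  \<open>2 * m - len (Suc n)\<close>, which minimality and parity force to equal
  \<open>len n\<close>. The border of \<open>len n\<close> inside \<open>m\<close> has the opposite
  type and is followed by 0, so it is 1 or 101. Both equations together give the sums 2 and
  6.\<close>

lemma no_pal_prefix_same:
  assumes "pal_prefix up (exch n) (len n)" "followed_by_1 (len n)" "len (Suc n) = 2 * len n - e"
    and "e < len n" "even e"
    and small: "\<And>q. q < len n \<Longrightarrow> pal_prefix up (exch n) q \<Longrightarrow> q \<le> e \<or> odd q"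
    and m: "len n < m" "m < len (Suc n)" "pal_prefix up (\<not> exch n) m"
  shows "exch n" "len n + e = 2 \<or> len n + e = 6" "m + 1 = 2 * len n \<or> m + 3 = 2 * len n"
proof -
  let ?b = "len n" and ?c = "len (Suc n)"
  have c: "pal_prefix up (exch n) ?c" by (rule pal_prefix_len)
  have "pal_prefix up (exch n) (2 * m - ?c)" "up (2 * m - ?c) = (up m = ((\<not> exch n) = exch n))"
    using pal_prefix_border[OF m(3) c m(2)] m(1) assms(3) by auto
  note y = this
  have yb: "2 * m - ?c = ?b"
  proof (rule ccontr)
    assume "2 * m - ?c \<noteq> ?b"
    then consider "?b < 2 * m - ?c" | "2 * m - ?c < ?b" by linarith
    then show False
    proof cases
      case 1 then show ?thesis using len_minimal[OF y(1)] m(2) by linarith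
    next
      case 2
      then have "2 * m - ?c \<le> e \<or> odd (2 * m - ?c)" using small y(1) by blast
      moreover have "2 * m - ?c = 2 * (m - ?b) + e" using m assms(3,4) by linarith
      ultimately show ?thesis using m(1) assms(5) by auto
    qed
  qed
  have m2: "m \<le> 2 * ?b" using m assms(3) by linarith
  note z = pal_prefix_border[OF assms(1) m(3) m(1) m2]
  then have "\<not> up (2 * ?b - m)" using up_len by blast
  moreover have "2 * ?b - m < ?b" using m(1) m2 assms(4) by linarith
  ultimately have "\<not> (\<not> exch n) \<and> (2 * ?b - m = 1 \<or> 2 * ?b - m = 3)"
    using followed_by_1D[OF assms(2) _ z(1)] by blast
  then show "exch n" "?b + e = 2 \<or> ?b + e = 6" "m + 1 = 2 * ?b \<or> m + 3 = 2 * ?b"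
    using yb m assms(3,4) by auto
qed

lemma not_both_pal_prefix:
  assumes "pal_prefix u True m" "pal_prefix u False m"
  shows "m = 0"
proof (rule ccontr)
  assume "m \<noteq> 0"
  then have "0 + (m - 1) + 1 = m" by simp
  from pal_prefixD[OF assms(1) this] pal_prefixD[OF assms(2) this] show False by blast
qed

section \<open>Recursion over blocks of four closures\<close>

lemma len_0: "len 0 = 0"
  by (simp add: len_def)

lemma pal_prefix_0: "pal_prefix u s 0"
  by (simp add: pal_prefix_def)

lemma initial_values:
  shows "up 0" "\<not> up 1" "up 2" "\<not> up 3" "len 1 = 2"
proof -
  show u0: "up 0" using up_len[of 0] by (simp add: len_0)
  have ex: "exch 0" "exch 1" by (simp_all add: exch_def)
  have l1: "len (Suc 0) = 2"
    using len_Suc_RE[of 0] ex by (simp add: len_0 pal_prefix_0 followed_by_1_def)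
  then show l: "len 1 = 2" by simp
  have p: "pal_prefix up True 2"
    using pal_prefix_len[of 0] l1 ex by simp
  show "\<not> up 1" using pal_prefixD[OF p, of 0 1] u0 by simp
  show "up 2" using up_len[of 1] l by simp
  \<comment> \<open>The empty prefix serves as \<open>e\<close>; the only competing length, 1, is
    odd.\<close>
  have "len (Suc 1) = 2 * len 1 - 0"
  proof (rule len_Suc_same)
    fix m assume "0 < m" "m < len 1" "pal_prefix up (exch 1) m"
    then have "even m" "m = 1" using even_pal_prefix_E[of up m] ex(2) l by simp_all
    then show "\<not> up m" by simp
  qed (simp_all only: p ex l u0 pal_prefix_0)
  then have "pal_prefix up True 4"
    using pal_prefix_len[of 1] l ex by simp
  from pal_prefixD[OF this, of 0 3] show "\<not> up 3" using u0 by simp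
qed

text \<open>\<open>e\<close> is the length of the longest \<open>E\<close>-palindromic prefix of \<open>w\<^sub>4\<^sub>k\<close>.\<close>

definition block_invariant :: "nat \<Rightarrow> nat \<Rightarrow> bool" where
  "block_invariant k e \<longleftrightarrow>
     pal_prefix up False (len (4 * k)) \<and> pal_prefix up True e \<and> even (len (4 * k)) \<and>
     followed_by_1 (len (4 * k)) \<and> (\<forall>m\<le>len (4 * k). pal_prefix up True m \<longrightarrow> m \<le> e) \<and>
     (len (4 * k) = 0 \<and> e = 0 \<or> 4 \<le> e \<and> e < len (4 * k))"

lemma block_invariant_0: "block_invariant 0 0"
  by (simp add: block_invariant_def len_0 pal_prefix_0 followed_by_1_def)

text \<open>The closures E, E, R, R act on palindromes of types R, E, E, R, so changes of type and
  equal types alternate. Between consecutive lengths, minimality rules out palindromic prefixes of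
  the closing type and the exclusion lemmas handle the other type.\<close>

lemma block_step:
  assumes "block_invariant k e"
  shows "len (4 * k + 1) = 2 * len (4 * k) + 2"
    "len (4 * k + 2) = 2 * len (4 * k + 1) - e"
    "len (4 * k + 3) = 2 * len (4 * k + 2) - 3"
    "len (4 * k + 4) = 2 * len (4 * k + 3) - len (4 * k)"
    "block_invariant (Suc k) (len (4 * k + 2))"
proof -
  define n where "n = 4 * k"
  note iv = initial_values
  have ex: "exch n" "exch (n + 1)" "\<not> exch (n + 2)" "\<not> exch (n + 3)"
    unfolding exch_def n_def by presburger+
  have S: "Suc n = n + 1" "Suc (n + 1) = n + 2" "Suc (n + 2) = n + 3" "Suc (n + 3) = n + 4" by simp_all
  have inv: "pal_prefix up False (len n)" "pal_prefix up True e" "even (len n)" "followed_by_1 (len n)"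
    "\<And>m. m \<le> len n \<Longrightarrow> pal_prefix up True m \<Longrightarrow> m \<le> e"
    "len n = 0 \<and> e = 0 \<or> 4 \<le> e \<and> e < len n"
    using assms unfolding block_invariant_def n_def by blast+
  have lt: "len n < len (n + 1)" "len (n + 1) < len (n + 2)" "len (n + 2) < len (n + 3)" "len (n + 3) < len (n + 4)"
    using len_less_Suc[of n] len_less_Suc[of "n + 1"] len_less_Suc[of "n + 2"] len_less_Suc[of "n + 3"]
    unfolding S by auto
  have P: "pal_prefix up True (len (n + 1))" "pal_prefix up True (len (n + 2))"
    "pal_prefix up False (len (n + 3))" "pal_prefix up False (len (n + 4))"
    using pal_prefix_len[of n] pal_prefix_len[of "n + 1"] pal_prefix_len[of "n + 2"] pal_prefix_len[of "n + 3"] ex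
    unfolding S by simp_all
  have mini: "\<not> pal_prefix up True m" if "len n < m" "m < len (n + 1)" for m
    using len_minimal[of n m] that ex(1) unfolding S by auto
  have mini1: "\<not> pal_prefix up True m" if "len (n + 1) < m" "m < len (n + 2)" for m
    using len_minimal[of "n + 1" m] that ex(2) unfolding S by auto
  have mini2: "\<not> pal_prefix up False m" if "len (n + 2) < m" "m < len (n + 3)" for m
    using len_minimal[of "n + 2" m] that ex(3) unfolding S by auto
  have mini3: "\<not> pal_prefix up False m" if "len (n + 3) < m" "m < len (n + 4)" for m
    using len_minimal[of "n + 3" m] that ex(4) unfolding S by auto

  have b: "len (n + 1) = 2 * len n + 2"
    using len_Suc_RE[OF ex(1) inv(1,4)] unfolding S .
  have R1: "m = 1" if "len n < m" "m < len (n + 1)" "pal_prefix up False m" for m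
    using no_pal_prefix_RE[OF inv(1,4) _ ex(1) iv(1) _ that(1) _ that(3)] that(2) b inv(6) iv(2)
    unfolding S by auto
  have fb: "followed_by_1 (len (n + 1))"
    using inv(4) by (rule followed_by_1_extend) (use mini R1 in \<open>metis (full_types)\<close>)
  have E1: "m \<le> e" if "m < len (n + 1)" "pal_prefix up True m" for m
    using mini inv(5) that by (meson not_le)
  have eb: "e < len (n + 1)" using inv(6) b by linarith
  have upe: "up e" using followed_by_1D[OF fb eb inv(2)] by blast

  have c: "len (n + 2) = 2 * len (n + 1) - e"
    using len_Suc_same[of "n + 1" e] P(1) inv(2) upe eb E1 ex(2) unfolding S by (metis (full_types) not_le)
  have R2: "m = 3" if "len (n + 1) < m" "m < len (n + 2)" "pal_prefix up False m" for m
  proof -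
    \<comment> \<open>Only the first block, with \<open>len n = 0\<close> and \<open>e = 0\<close>,
      meets these equations, and there m = 3.\<close>
    have *: "len (n + 1) + e = 2 \<or> len (n + 1) + e = 6" "m + 1 = 2 * len (n + 1) \<or> m + 3 = 2 * len (n + 1)"
      using no_pal_prefix_same(2,3)[of "n + 1" e m] P(1) fb c eb even_pal_prefix_E[OF inv(2)] E1 that ex(2)
      unfolding S by simp_all
    then show ?thesis using inv(6) b that(1) by auto
  qed
  have fc: "followed_by_1 (len (n + 2))"
    using fb by (rule followed_by_1_extend) (use mini1 R2 in \<open>metis (full_types)\<close>)

  have c4: "4 \<le> len (n + 2)" using c b inv(6) by linarith
  have d: "len (n + 3) = 2 * len (n + 2) - 3"
    using len_Suc_ER[OF ex(3) P(2) fc c4 iv(1-4)] unfolding S .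
  have E3: "\<not> pal_prefix up True m" if "len (n + 2) < m" "m < len (n + 3)" for m
    using no_pal_prefix_ER[OF P(2) fc _ ex(3) c4 iv(4) that(1)] that(2) d unfolding S by blast
  have fd: "followed_by_1 (len (n + 3))"
    using fc by (rule followed_by_1_extend) (use mini2 E3 in \<open>metis (full_types)\<close>)
  have R3: "m = 1 \<or> m = 3" if "len n < m" "m < len (n + 3)" "pal_prefix up False m" for m
  proof -
    consider "m < len (n + 1)" | "m = len (n + 1)" | "len (n + 1) < m" "m < len (n + 2)"
      | "m = len (n + 2)" | "len (n + 2) < m" by linarith
    then show ?thesis
    proof cases
      case 1 then show ?thesis using R1 that by blast
    next
      case 2 then show ?thesis using not_both_pal_prefix P(1) that by force
    next
      case 3 then show ?thesis using R2 that by blast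
    next
      case 4 then show ?thesis using not_both_pal_prefix P(2) that by force
    next
      case 5 then show ?thesis using mini2 that by blast
    qed
  qed
  have ad: "len n < len (n + 3)" using lt by linarith
  \<comment> \<open>Positions 1 and 3 carry 0, so \<open>len n\<close> can serve as \<open>e\<close>
    for the fourth closure.\<close>
  have "\<not> up m" if "len n < m" "m < len (n + 3)" "pal_prefix up False m" for m
    using R3[OF that] iv by blast
  then have f: "len (n + 4) = 2 * len (n + 3) - len n"
    using len_Suc_same[of "n + 3" "len n"] P(3) inv(1) up_len[of n] ad ex(4) unfolding S by simp
  have E4: "\<not> pal_prefix up True m" if "len (n + 3) < m" "m < len (n + 4)" for m
  proof
    assume m: "pal_prefix up True m"
    have "q \<le> len n \<or> odd q" if "q < len (n + 3)" "pal_prefix up (exch (n + 3)) q" for q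
      using R3[of q] that ex(4) by fastforce
    then have "exch (n + 3)"
      using no_pal_prefix_same(1)[of "n + 3" "len n" m] P(3) fd f ad inv(3) that m ex(4)
      unfolding S by simp
    then show False using ex(4) by blast
  qed
  have ff: "followed_by_1 (len (n + 4))"
    using fd by (rule followed_by_1_extend) (use mini3 E4 in \<open>metis (full_types)\<close>)
  have odd_d: "odd (len (n + 3))" using d c4 by simp
  \<comment> \<open>This makes \<open>len (n + 2)\<close> the \<open>e\<close> of the next
    block.\<close>
  have E: "m \<le> len (n + 2)" if m: "m \<le> len (n + 4)" "pal_prefix up True m" for m
  proof (rule ccontr)
    assume "\<not> m \<le> len (n + 2)"
    then consider "len (n + 2) < m" "m < len (n + 3)" | "m = len (n + 3)"
      | "len (n + 3) < m" "m < len (n + 4)" | "m = len (n + 4)" using m(1) by linarith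
    then show False
    proof cases
      case 1 then show ?thesis using E3 m by blast
    next
      case 2 then show ?thesis using odd_d even_pal_prefix_E m by blast
    next
      case 3 then show ?thesis using E4 m by blast
    next
      case 4 then show ?thesis using not_both_pal_prefix[OF m(2)] P(4) lt by auto
    qed
  qed
  have ev: "even (len (n + 4))" using f inv(3) ad by simp
  show "len (4 * k + 1) = 2 * len (4 * k) + 2" "len (4 * k + 2) = 2 * len (4 * k + 1) - e"
    "len (4 * k + 3) = 2 * len (4 * k + 2) - 3" "len (4 * k + 4) = 2 * len (4 * k + 3) - len (4 * k)"
    using b c d f unfolding n_def .
  have eqs: "4 * Suc k = n + 4" "4 * k + 2 = n + 2" by (simp_all add: n_def)
  show "block_invariant (Suc k) (len (4 * k + 2))"
    unfolding block_invariant_def eqs using P(2,4) ev ff E c4 lt by auto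
qed

text \<open>The quantity \<open>e\<close> as a function of the block; the first block has no
  predecessor and uses the empty prefix.\<close>

fun prev_len :: "nat \<Rightarrow> nat" where
  "prev_len 0 = 0"
| "prev_len (Suc k) = len (4 * k + 2)"

lemma block_invariant: "block_invariant k (prev_len k)"
proof (induction k)
  case (Suc k)
  from block_step(5)[OF this] show ?case by simp
qed (simp add: block_invariant_0)

lemmas len_block = block_step(1-4)[OF block_invariant]

section \<open>Left special factors\<close>

lemma le_len: "n \<le> len n"
  unfolding len_def by (rule length_pseudostandard_prefix_ge)

lemma Suc_block:
  fixes k :: nat
  shows "Suc (4 * k) = 4 * k + 1" "Suc (4 * k + 1) = 4 * k + 2"
    "Suc (4 * k + 2) = 4 * k + 3" "Suc (4 * k + 3) = 4 * k + 4"
  by simp_all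

lemma pal_prefix_block:
  "pal_prefix up False (len (4 * k))" "pal_prefix up True (len (4 * k + 1))"
  "pal_prefix up True (len (4 * k + 2))" "pal_prefix up False (len (4 * k + 3))"
  "pal_prefix up False (len (4 * k + 4))"
proof -
  have ex: "exch (4 * k)" "exch (4 * k + 1)" "\<not> exch (4 * k + 2)" "\<not> exch (4 * k + 3)"
    unfolding exch_def by presburger+
  show "pal_prefix up False (len (4 * k))"
    using block_invariant[of k] unfolding block_invariant_def by blast
  show "pal_prefix up True (len (4 * k + 1))" "pal_prefix up True (len (4 * k + 2))"
    "pal_prefix up False (len (4 * k + 3))" "pal_prefix up False (len (4 * k + 4))"
    using pal_prefix_len[of "4 * k"] pal_prefix_len[of "4 * k + 1"]
      pal_prefix_len[of "4 * k + 2"] pal_prefix_len[of "4 * k + 3"] ex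
    unfolding Suc_block by simp_all
qed

lemma len_block_less:
  "len (4 * k) < len (4 * k + 1)" "len (4 * k + 1) < len (4 * k + 2)"
  "len (4 * k + 2) < len (4 * k + 3)" "len (4 * k + 3) < len (4 * k + 4)"
  using len_less_Suc[of "4 * k"] len_less_Suc[of "4 * k + 1"]
    len_less_Suc[of "4 * k + 2"] len_less_Suc[of "4 * k + 3"]
  by (simp_all only: Suc_block)

text \<open>The E-closure is \<open>w_p (4 * k)\<close> followed by 10 and its image under
  \<open>E\<close>, and the image of an R-palindrome under \<open>E\<close> is its letterwise
  complement.\<close>

lemma up_complement_shift:
  assumes "i < len (4 * k)"
  shows "up (len (4 * k) + 2 + i) = (\<not> up i)"
proof -
  let ?a = "len (4 * k)"
  have "up (?a + 2 + i) = (up (?a - 1 - i) \<noteq> True)"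
    by (rule pal_prefixD[OF pal_prefix_block(2)[of k]]) (use assms len_block(1)[of k] in simp)
  moreover have "up (?a - 1 - i) = (up i \<noteq> False)"
    by (rule pal_prefixD[OF pal_prefix_block(1)[of k]]) (use assms in simp)
  ultimately show ?thesis by blast
qed

text \<open>Some R-palindrome \<open>w_p (4 * k)\<close> is long enough to contain the given factor,
  and it recurs complemented two letters after its end.\<close>

lemma complement_occurs: "\<exists>q. \<forall>i<n. up (q + i) = (\<not> up (p + i))"
proof -
  let ?a = "len (4 * (p + n))"
  have "up (?a + 2 + p + i) = (\<not> up (p + i))" if "i < n" for i
  proof -
    have "p + i < 4 * (p + n)" using that by simp
    then have "p + i < ?a" using le_len by (rule less_le_trans)
    then show ?thesis using up_complement_shift[of "p + i" "p + n"] by (simp add: add.assoc)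
  qed
  then show ?thesis by blast
qed

text \<open>A factor is encoded by the first \<open>n\<close> values of \<open>f\<close>, so
  \<open>up\<close> itself stands for every prefix. Starting at p + 1 guarantees a preceding
  letter.\<close>

definition left_special :: "nat \<Rightarrow> (nat \<Rightarrow> bool) \<Rightarrow> bool" where
  "left_special n f \<longleftrightarrow> (\<forall>b. \<exists>p. up p = b \<and> (\<forall>i<n. up (p + 1 + i) = f i))"

text \<open>Complementing the second occurrence turns it into \<open>f\<close> and flips the letter
  in front, which supplies the other left extension.\<close>

lemma left_specialI:
  assumes "\<forall>i<n. up (p + 1 + i) = f i" "\<forall>i<n. up (q + 1 + i) = (\<not> f i)" "up p = up q"
  shows "left_special n f"
  unfolding left_special_def
proof
  fix b
  obtain r where r: "\<forall>i<Suc n. up (r + i) = (\<not> up (q + i))" using complement_occurs by blast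
  have "up (r + 1 + i) = f i" if "i < n" for i
    using r[rule_format, of "Suc i"] assms(2) that by simp
  moreover have "up r = (\<not> up p)" using r[rule_format, of 0] assms(3) by simp
  ultimately show "\<exists>p. up p = b \<and> (\<forall>i<n. up (p + 1 + i) = f i)"
    using assms(1) by (metis (full_types))
qed

lemma left_special_Not:
  assumes "left_special n f"
  shows "left_special n (\<lambda>i. \<not> f i)"
  unfolding left_special_def
proof
  fix b
  obtain p where p: "up p = (\<not> b)" "\<forall>i<n. up (p + 1 + i) = f i"
    using assms unfolding left_special_def by blast
  obtain r where r: "\<forall>i<Suc n. up (r + i) = (\<not> up (p + i))" using complement_occurs by blast
  have "up (r + 1 + i) = (\<not> f i)" if "i < n" for i
    using r[rule_format, of "Suc i"] p(2) that by simp
  moreover have "up r = b" using r[rule_format, of 0] p(1) by simp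
  ultimately show "\<exists>p. up p = b \<and> (\<forall>i<n. up (p + 1 + i) = (\<not> f i))" by blast
qed

text \<open>A palindromic prefix of the same type is also a suffix; the letter before that suffix is
  the image of the 1 after the prefix.\<close>

lemma palindrome_recurs:
  assumes "pal_prefix up s l" "pal_prefix up s m" "l < m" "up l"
  shows "up (m - 1 - l) = (\<not> s)" "i < l \<Longrightarrow> up (m - l + i) = up i"
proof -
  have "up (m - 1 - l) = (up l \<noteq> s)"
    by (rule pal_prefixD[OF assms(2)]) (use assms(3) in simp)
  then show "up (m - 1 - l) = (\<not> s)" using assms(4) by blast
  assume i: "i < l"
  have "up (m - l + i) = (up (l - 1 - i) \<noteq> s)"
    by (rule pal_prefixD[OF assms(2)]) (use assms(3) i in simp)
  moreover have "up (l - 1 - i) = (up i \<noteq> s)"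
    by (rule pal_prefixD[OF assms(1)]) (use i in simp)
  ultimately show "up (m - l + i) = up i" by blast
qed

text \<open>Two nested R-palindromes supply the left extension 1, two nested E-palindromes the left
  extension 0.\<close>

lemma left_special_up: "left_special n up"
  unfolding left_special_def
proof
  fix b
  have n: "n \<le> len (4 * n + 1)" "n \<le> len (4 * n + 3)"
    using le_len[of "4 * n + 1"] le_len[of "4 * n + 3"] by linarith+
  have rec: "\<exists>p. up p = (\<not> s) \<and> (\<forall>i<n. up (p + 1 + i) = up i)"
    if "pal_prefix up s (len l)" "pal_prefix up s (len m)" "len l < len m" "n \<le> len l" for s l m
  proof (intro exI conjI allI impI)
    show "up (len m - 1 - len l) = (\<not> s)"
      using palindrome_recurs(1) that(1-3) up_len by blast
    fix i assume "i < n"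
    moreover have "len m - 1 - len l + 1 + i = len m - len l + i" using that(3) by simp
    ultimately show "up (len m - 1 - len l + 1 + i) = up i"
      using palindrome_recurs(2)[OF that(1-3) up_len, of i] that(4) by simp
  qed
  show "\<exists>p. up p = b \<and> (\<forall>i<n. up (p + 1 + i) = up i)"
    using rec[OF pal_prefix_block(4,5) len_block_less(4) n(2)]
      rec[OF pal_prefix_block(2,3) len_block_less(2) n(1)] by (cases b) simp_all
qed

text \<open>
The \<open>b\<close>-prefix is the central factor of \<open>w\<^sub>4\<^sub>k\<^sub>+\<^sub>5\<close> and is followed by 0 there; the second left
extension comes from the complement of the \<open>b\<close>-prefix, which is a suffix of the \<open>R\<close>-palindrome
\<open>w\<^sub>4\<^sub>k\<^sub>+\<^sub>3\<close> and is followed by 1.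
\<close>

lemma branch_E:
  assumes "len (4 * k + 1) < n" "n \<le> len (4 * k + 3)"
  shows "\<exists>f. left_special n f \<and> f 0 \<and> (\<exists>j<n. f j \<noteq> up j)"
proof -
  define a b d a' where "a = len (4 * k)" "b = len (4 * k + 1)" "d = len (4 * k + 3)" "a' = len (4 * k + 4)"
  note defs = this
  have lens: "b = 2 * a + 2" "a' = 2 * d - a" and lt: "b < d" "d < a'"
    using len_block[of k] len_block_less[of k] unfolding defs by auto
  have P: "pal_prefix up False a" "pal_prefix up True b" "pal_prefix up False d" "pal_prefix up False a'"
    using pal_prefix_block[of k] unfolding defs by auto
  have ones: "up a" "up b" "up d" "up a'" using up_len unfolding defs by auto
  have shift: "up (a + 2 + i) = (\<not> up i)" if "i < a" for i
    using up_complement_shift[of i k] that unfolding defs .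
  have shift': "up (a' + 2 + i) = (\<not> up i)" if "i < a'" for i
    using up_complement_shift[of i "Suc k"] that unfolding defs by (simp add: add.commute)
  have next_a: "\<not> up (a + 1)"
    using pal_prefixD[OF P(2), of a "a + 1"] ones(1) lens(1) by simp
  have next_a': "\<not> up (a' + 1)"
    using pal_prefixD[OF pal_prefix_block(2)[of "Suc k"], of a' "a' + 1"] ones(4) len_block(1)[of "Suc k"]
    unfolding defs by (simp add: add.commute)
  \<comment> \<open>The central factor of length b = 2a + 2 in the palindrome of length 2a' + 2
    starts at a' - a; \<open>f\<close> reads on past its end.\<close>
  define f where "f i = up (a' - a + i)" for i
  have f_up: "f i = up i" if "i < b" for i
  proof -
    consider "i < a" | "i = a" | "i = a + 1" | "a + 2 \<le> i" by linarith
    then show ?thesis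
    proof cases
      case 1
      then show ?thesis
        using palindrome_recurs(2)[OF P(1,4) _ ones(1) 1] lt lens by (simp add: f_def)
    next
      case 2
      then show ?thesis using ones lt lens by (simp add: f_def)
    next
      case 3
      then show ?thesis using next_a next_a' lt lens by (simp add: f_def)
    next
      case 4
      then obtain j where j: "i = a + 2 + j" using le_Suc_ex by blast
      then have "j < a" using that lens by linarith
      with j have "f i = up (a' + 2 + j)" using lt lens by (simp add: f_def add.commute)
      then show ?thesis using shift[of j] shift'[of j] j \<open>j < a\<close> lt lens by simp
    qed
  qed
  \<comment> \<open>Since a < b, the range covers every n up to d. Beyond b both sides are traced
    back to position a + j.\<close>
  have f_d: "up (d - b + i) = (\<not> f i)" if "i < b + d - a" for i
  proof (cases "i < b")
    case True
    have "up (d - b + i) = (up (b - 1 - i) \<noteq> False)"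
      by (rule pal_prefixD[OF P(3)]) (use True lt in simp)
    moreover have "up (b - 1 - i) = (up i \<noteq> True)"
      by (rule pal_prefixD[OF P(2)]) (use True in simp)
    ultimately show ?thesis using f_up[OF True] by blast
  next
    case False
    then obtain j where "i = b + j" using le_Suc_ex not_le by blast
    moreover from this have "j < d - a" using that by linarith
    ultimately have j: "i = b + j" "j < d - a" .
    have "up (d + j) = (up (d - a - 1 - j) \<noteq> False)"
      by (rule pal_prefixD[OF P(4)]) (use j lt lens in linarith)
    moreover have "up (d - a - 1 - j) = (up (a + j) \<noteq> False)"
      by (rule pal_prefixD[OF P(3)]) (use j lt lens in linarith)
    moreover have "f i = up (a' + 2 + (a + j))" using j lt lens by (simp add: f_def add.commute)
    moreover have "a + j < a'" using j lt by linarith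
    ultimately show ?thesis using shift'[of "a + j"] j lt by simp
  qed
  have n: "n \<le> b + d - a" "b < n" using assms lens unfolding defs by linarith+
  have "left_special n f"
  proof (rule left_specialI[of n "a' - 1 - a" f "d - 1 - b"])
    show "\<forall>i<n. up (a' - 1 - a + 1 + i) = f i"
    proof -
      have "a' - 1 - a + 1 = a' - a" using lt lens by linarith
      then show ?thesis by (simp only: f_def) blast
    qed
    show "\<forall>i<n. up (d - 1 - b + 1 + i) = (\<not> f i)"
    proof -
      have "d - 1 - b + 1 = d - b" using lt by linarith
      then show ?thesis using f_d n(1) by (simp only:) (meson less_le_trans)
    qed
    have "up (d - 1 - b) = (up b \<noteq> False)"
      by (rule pal_prefixD[OF P(3)]) (use lt in linarith)
    then show "up (a' - 1 - a) = up (d - 1 - b)"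
      using palindrome_recurs(1)[OF P(1,4) _ ones(1)] ones(2) lt lens by simp
  qed
  moreover have "f 0" using f_up[of 0] initial_values lens by simp
  moreover have "f b \<noteq> up b" using f_d[of b] ones n lt by simp
  ultimately show ?thesis using n(2) by blast
qed

text \<open>
Likewise the \<open>d\<close>-prefix is the central factor of \<open>w\<^sub>4\<^sub>k\<^sub>+\<^sub>7\<close>, and its complement is a suffix of the
\<open>E\<close>-palindrome \<open>w\<^sub>4\<^sub>k\<^sub>+\<^sub>5\<close>.
\<close>

lemma branch_R:
  assumes "len (4 * k + 3) < n" "n \<le> len (4 * k + 5)"
  shows "\<exists>f. left_special n f \<and> f 0 \<and> (\<exists>j<n. f j \<noteq> up j)"
proof -
  define c d b' c' d' where "c = len (4 * k + 2)" "d = len (4 * k + 3)" "b' = len (4 * Suc k + 1)"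
    "c' = len (4 * Suc k + 2)" "d' = len (4 * Suc k + 3)"
  note defs = this
  have lens: "d = 2 * c - 3" "c' = 2 * b' - c" "d' = 2 * c' - 3"
    using len_block(3)[of k] len_block(2,3)[of "Suc k"] unfolding defs by auto
  have lt: "c < d" "d < b'" "b' < c'" "c' < d'"
    using len_block_less[of k] len_block_less[of "Suc k"] unfolding defs by (auto simp: add.commute)
  have P: "pal_prefix up True c" "pal_prefix up False d" "pal_prefix up True b'"
    "pal_prefix up True c'" "pal_prefix up False d'"
    using pal_prefix_block[of k] pal_prefix_block[of "Suc k"] unfolding defs by blast+
  have ones: "up c" "up d" "up b'" using up_len unfolding defs by auto
  \<comment> \<open>The central factor of length d = 2c - 3 in the palindrome of length 2c' - 3
    starts at c' - c.\<close>
  define f where "f i = up (c' - c + i)" for i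
  have f_up: "f i = up i" if "i < d" for i
  proof (cases "i < c")
    case True
    then show ?thesis
      using palindrome_recurs(2)[OF P(1,4) _ ones(1) True] lt by (simp add: f_def)
  next
    case False
    \<comment> \<open>Two reflections of each side meet at position 3 + i - c.\<close>
    have "f i = (up (c' - 4 + c - i) \<noteq> False)"
      unfolding f_def by (rule pal_prefixD[OF P(5)]) (use False that lt lens in linarith)
    moreover have "up (c' - 4 + c - i) = (up (3 + i - c) \<noteq> True)"
      by (rule pal_prefixD[OF P(4)]) (use False that lt lens in linarith)
    moreover have "up i = (up (2 * c - 4 - i) \<noteq> False)"
      by (rule pal_prefixD[OF P(2)]) (use False that lt lens in linarith)
    moreover have "up (2 * c - 4 - i) = (up (3 + i - c) \<noteq> True)"
      by (rule pal_prefixD[OF P(1)]) (use False that lt lens in linarith)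
    ultimately show ?thesis by blast
  qed
  have f_b: "up (b' - d + i) = (\<not> f i)" if "i < d + b' - c" for i
  proof (cases "i < d")
    case True
    have "up (b' - d + i) = (up (d - 1 - i) \<noteq> True)"
      by (rule pal_prefixD[OF P(3)]) (use True lt in simp)
    moreover have "up (d - 1 - i) = (up i \<noteq> False)"
      by (rule pal_prefixD[OF P(2)]) (use True in simp)
    ultimately show ?thesis using f_up[OF True] by blast
  next
    case False
    then obtain j where j: "i = d + j" using le_Suc_ex not_le by blast
    then have j': "j < b' - c" using that lt by linarith
    have "up (b' + j) = (up (b' - c - 1 - j) \<noteq> True)"
      by (rule pal_prefixD[OF P(4)]) (use j' lt lens in linarith)
    moreover have "up (b' - c - 1 - j) = (up (c + j) \<noteq> True)"
      by (rule pal_prefixD[OF P(3)]) (use j' lt lens in linarith)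
    moreover have "up (c' - c + i) = (up (c' - c - 1 - j) \<noteq> False)"
      by (rule pal_prefixD[OF P(5)]) (use j j' lt lens in linarith)
    moreover have "up (c' - c - 1 - j) = (up (c + j) \<noteq> True)"
      by (rule pal_prefixD[OF P(4)]) (use j j' lt lens in linarith)
    ultimately show ?thesis using j lt by (simp add: f_def)
  qed
  have eq: "4 * k + 5 = 4 * Suc k + 1" by simp
  have "n \<le> b'" "d < n" using assms unfolding defs eq by blast+
  then have n: "n \<le> d + b' - c" "d < n" using lt by linarith+
  have "left_special n f"
  proof (rule left_specialI[of n "c' - 1 - c" f "b' - 1 - d"])
    show "\<forall>i<n. up (c' - 1 - c + 1 + i) = f i"
    proof -
      have "c' - 1 - c + 1 = c' - c" using lt by linarith
      then show ?thesis by (simp only: f_def) blast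
    qed
    show "\<forall>i<n. up (b' - 1 - d + 1 + i) = (\<not> f i)"
    proof -
      have "b' - 1 - d + 1 = b' - d" using lt by linarith
      then show ?thesis using f_b n(1) by (simp only:) (meson less_le_trans)
    qed
    have "up (b' - 1 - d) = (up d \<noteq> True)"
      by (rule pal_prefixD[OF P(3)]) (use lt in linarith)
    then show "up (c' - 1 - c) = up (b' - 1 - d)"
      using palindrome_recurs(1)[OF P(1,4) _ ones(1)] ones(2) lt by simp
  qed
  moreover have "f 0" using f_up[of 0] initial_values lt by simp
  moreover have "f d \<noteq> up d" using f_b[of d] ones n lt by simp
  ultimately show ?thesis using n(2) by blast
qed

lemma left_special_branch:
  assumes "2 < n"
  shows "\<exists>f. left_special n f \<and> f 0 \<and> (\<exists>j<n. f j \<noteq> up j)"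
proof -
  have ex: "n \<le> len (2 * n + 1)" using le_len[of "2 * n + 1"] by linarith
  define j where "j = (LEAST j. n \<le> len (2 * j + 1))"
  have j: "n \<le> len (2 * j + 1)" unfolding j_def using ex by (rule LeastI)
  \<comment> \<open>Here \<open>len 1 = 2 < n\<close>, so an earlier odd index exists.\<close>
  have "j \<noteq> 0" using j initial_values(5) assms by (intro notI) simp
  then obtain i where i: "j = Suc i" by (cases j) auto
  have i1: "len (2 * i + 1) < n"
    using not_less_Least[of i "\<lambda>j. n \<le> len (2 * j + 1)"] i unfolding j_def[symmetric] by simp
  have "2 * j + 1 = 2 * i + 3" using i by simp
  with j have i2: "n \<le> len (2 * i + 3)" by (simp only:)
  show ?thesis
  proof (cases "even i")
    case True
    then obtain k where "i = 2 * k" by blast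
    then have eqs: "2 * i + 1 = 4 * k + 1" "2 * i + 3 = 4 * k + 3" by simp_all
    show ?thesis using branch_E[of k n] i1 i2 unfolding eqs by blast
  next
    case False
    then obtain k where "i = 2 * k + 1" using oddE by blast
    then have eqs: "2 * i + 1 = 4 * k + 3" "2 * i + 3 = 4 * k + 5" by simp_all
    show ?thesis using branch_R[of k n] i1 i2 unfolding eqs by blast
  qed
qed

section \<open>Factor complexity\<close>

lemma mem_factors: "x \<in> factors u_p n \<longleftrightarrow> (\<exists>p. x = map (\<lambda>i. up (p + i)) [0..<n])"
proof -
  have "stake n (sdrop p u_p) = map (\<lambda>i. up (p + i)) [0..<n]" for p
    by (rule nth_equalityI) (simp_all add: stake_nth sdrop_snth up_def)
  then show ?thesis by (simp add: factors_def)
qed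

section \<open>Counting the factors of length 10\<close>

definition pal_extend :: "bool \<Rightarrow> nat \<Rightarrow> word \<Rightarrow> word" where
  "pal_extend s m xs = xs @ map (\<lambda>x. x \<noteq> s) (rev (take (m - length xs) xs))"

lemma map_eq_pal_extend:
  assumes "pal_prefix u s m" "k \<le> m" "m \<le> 2 * k"
  shows "map u [0..<m] = pal_extend s m (map u [0..<k])"
proof (rule nth_equalityI)
  fix i assume "i < length (map u [0..<m])"
  then have i: "i < m" by simp
  have "u i = (u (m - 1 - i) \<noteq> s)"
    by (rule pal_prefixD[OF assms(1)]) (use i in simp)
  moreover have "rev (take (m - k) (map u [0..<k])) ! (i - k) = u (m - 1 - i)" if "k \<le> i"
  proof -
    have "m - k - Suc (i - k) = m - 1 - i" using that i by simp
    then show ?thesis using assms(2,3) that i by (simp add: rev_nth take_map)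
  qed
  ultimately show "map u [0..<m] ! i = pal_extend s m (map u [0..<k]) ! i"
    using i assms(2,3) by (cases "i < k") (simp_all add: pal_extend_def nth_append)
qed (use assms in \<open>simp add: pal_extend_def\<close>)

lemma len_values: "len (4 * 0 + 2) = 4" "len (4 * 0 + 3) = 5" "len (4 * 1) = 10"
  "len (4 * 1 + 1) = 22" "len (4 * 1 + 2) = 40" "len (4 * 1 + 3) = 77"
proof -
  note l0 = len_block[of 0, unfolded mult_0_right len_0 prev_len.simps]
  have l2: "len (0 + 2) = 4" using l0(1,2) by simp
  have l3: "len (0 + 3) = 5" using l0(3) unfolding l2 by simp
  have l4: "len (0 + 4) = 10" using l0(4) unfolding l3 by simp
  show "len (4 * 0 + 2) = 4" "len (4 * 0 + 3) = 5" using l2 l3 by simp_all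
  show a: "len (4 * 1) = 10" using l4 by simp
  have p: "prev_len 1 = 4" using l2 by simp
  note l1 = len_block[of 1, unfolded a p]
  show b: "len (4 * 1 + 1) = 22" using l1(1) by simp
  show c: "len (4 * 1 + 2) = 40" using l1(2) unfolding b by simp
  show "len (4 * 1 + 3) = 77" using l1(3) unfolding c by simp
qed

text \<open>The innermost word is \<open>w_p 3\<close>. A reflection at most doubles a word, so
  reaching 22 from 10 needs the next letter 1 first.\<close>

definition prefix_77 :: word where
  "prefix_77 = pal_extend False 77 (pal_extend True 40 (pal_extend True 22
     (pal_extend False 10 [True, False, True, False, True] @ [True])))"

lemma map_up_77: "map up [0..<77] = prefix_77"
proof -
  note P = pal_prefix_block(2-5)[of 1, unfolded len_values]
  have u4: "up 4" using up_len[of "4 * 0 + 2"] unfolding len_values .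
  have u10: "up 10" using up_len[of "4 * 1"] unfolding len_values .
  have "map up [0..<5] = [True, False, True, False, True]"
    using u4 initial_values by (simp add: eval_nat_numeral)
  moreover have "map up [0..<10] = pal_extend False 10 (map up [0..<5])"
    using pal_prefix_block(1)[of 1] unfolding len_values by (rule map_eq_pal_extend) simp_all
  moreover have "[0..<11] = [0..<10] @ [10]" by (simp add: upt_rec)
  ultimately have "map up [0..<11] = pal_extend False 10 [True, False, True, False, True] @ [True]"
    using u10 by simp
  moreover have "map up [0..<22] = pal_extend True 22 (map up [0..<11])"
    using P(1) by (rule map_eq_pal_extend) simp_all
  moreover have "map up [0..<40] = pal_extend True 40 (map up [0..<22])"
    using P(2) by (rule map_eq_pal_extend) simp_all
  moreover have "map up [0..<77] = pal_extend False 77 (map up [0..<40])"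
    using P(3) by (rule map_eq_pal_extend) simp_all
  ultimately show ?thesis by (simp only: prefix_77_def)
qed

lemma factor_complexity_10: "40 < factor_complexity u_p 10"
proof -
  \<comment> \<open>The 47 windows use the first 56 letters; their complements are factors
    too.\<close>
  define ws where "ws = concat (map (\<lambda>i. let v = take 10 (drop i prefix_77) in [v, map Not v]) [0..<47])"
  have "40 < length (remdups ws)"
    unfolding ws_def by code_simp
  also have "\<dots> = card (set ws)" by (rule length_remdups_card_conv)
  also have "\<dots> \<le> factor_complexity u_p 10"
    unfolding factor_complexity_def
  proof (rule card_mono[OF finite_factors], rule subsetI)
    fix x assume "x \<in> set ws"
    then obtain i where i: "i < 47" and x: "x = take 10 (drop i prefix_77) \<or> x = map Not (take 10 (drop i prefix_77))"
      unfolding ws_def by (auto simp: Let_def)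
    have v: "take 10 (drop i prefix_77) = map (\<lambda>j. up (i + j)) [0..<10]"
      unfolding map_up_77[symmetric] using i by (intro nth_equalityI) (simp_all add: take_map drop_map)
    obtain q where "\<forall>j<10. up (q + j) = (\<not> up (i + j))" using complement_occurs by blast
    then have "map Not (map (\<lambda>j. up (i + j)) [0..<10]) = map (\<lambda>j. up (q + j)) [0..<10]"
      by simp
    then show "x \<in> factors u_p 10"
      using x unfolding v mem_factors by metis
  qed
  finally show ?thesis .
qed

section \<open>Growth of the complexity\<close>

lemma left_special_word:
  assumes "left_special n f"
  shows "b # map f [0..<n] \<in> factors u_p (Suc n)"
proof -
  obtain p where p: "up p = b" "\<forall>i<n. up (p + 1 + i) = f i"
    using assms unfolding left_special_def by blast
  have "b # map f [0..<n] = map (\<lambda>i. up (p + i)) [0..<Suc n]"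
    using p by (intro nth_equalityI) (auto simp: nth_Cons split: nat.split simp del: upt_Suc)
  then show ?thesis unfolding mem_factors by (rule exI)
qed

lemma left_extension:
  assumes "x \<in> factors u_p n"
  shows "\<exists>b. b # x \<in> factors u_p (Suc n)"
proof -
  obtain p where x: "x = map (\<lambda>i. up (p + i)) [0..<n]"
    using assms unfolding mem_factors by blast
  show ?thesis
  proof (cases p)
    \<comment> \<open>Nothing precedes this occurrence, but prefixes are left special and so
      recur.\<close>
    case 0
    then show ?thesis using left_special_word[OF left_special_up] x by auto
  next
    case (Suc r)
    have "up r # x = map (\<lambda>i. up (r + i)) [0..<Suc n]"
      unfolding x Suc by (intro nth_equalityI) (auto simp: nth_Cons split: nat.split simp del: upt_Suc)
    then show ?thesis unfolding mem_factors by (intro exI)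
  qed
qed

text \<open>One chosen letter is put before each factor and the opposite letter before each member
  of \<open>S\<close>; the two sets are disjoint, since equal tails carry different first
  letters.\<close>

lemma factor_complexity_Suc_ge:
  assumes "finite S" "\<And>x b. x \<in> S \<Longrightarrow> b # x \<in> factors u_p (Suc n)"
  shows "factor_complexity u_p n + card S \<le> factor_complexity u_p (Suc n)"
proof -
  obtain e where e: "\<forall>x\<in>factors u_p n. e x # x \<in> factors u_p (Suc n)"
    using bchoice[of "factors u_p n" "\<lambda>x b. b # x \<in> factors u_p (Suc n)"] left_extension by blast
  let ?A = "(\<lambda>x. e x # x) ` factors u_p n" and ?B = "(\<lambda>x. (\<not> e x) # x) ` S"
  have "card (?A \<union> ?B) = card ?A + card ?B"
    by (rule card_Un_disjoint) (auto simp: finite_factors assms(1))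
  also have "\<dots> = card (factors u_p n) + card S"
    by (simp add: card_image inj_on_def)
  finally have "card (factors u_p n) + card S = card (?A \<union> ?B)" ..
  also have "\<dots> \<le> card (factors u_p (Suc n))"
    by (rule card_mono[OF finite_factors]) (use e assms(2) in blast)
  finally show ?thesis unfolding factor_complexity_def .
qed

lemma factor_complexity_Suc:
  assumes "2 < n"
  shows "factor_complexity u_p n + 4 \<le> factor_complexity u_p (Suc n)"
proof -
  obtain f j where f: "left_special n f" "f 0" "j < n" "f j \<noteq> up j"
    using left_special_branch[OF assms] by blast
  let ?w = "\<lambda>g :: nat \<Rightarrow> bool. map g [0..<n]"
  let ?L = "[?w up, ?w f, ?w (\<lambda>i. \<not> up i), ?w (\<lambda>i. \<not> f i)]"
  have "0 < n" "up 0" using assms initial_values by auto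
  have ne: "?w g \<noteq> ?w h" if "i < n" "g i \<noteq> h i" for g h i
    using that by (auto simp: list_eq_iff_nth_eq)
  \<comment> \<open>Position \<open>j\<close> separates \<open>up\<close> from \<open>f\<close>; the
    first letter, 1 in both, separates them from the complements.\<close>
  have "?w up \<noteq> ?w f" "?w (\<lambda>i. \<not> up i) \<noteq> ?w (\<lambda>i. \<not> f i)"
    by (rule ne[OF f(3)]; use f(4) in simp)+
  moreover have "?w up \<noteq> ?w (\<lambda>i. \<not> up i)" "?w up \<noteq> ?w (\<lambda>i. \<not> f i)"
    "?w f \<noteq> ?w (\<lambda>i. \<not> up i)" "?w f \<noteq> ?w (\<lambda>i. \<not> f i)"
    by (rule ne[OF \<open>0 < n\<close>]; use \<open>up 0\<close> f(2) in simp)+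
  ultimately have "distinct ?L"
    by (simp del: map_eq_conv)
  then have card: "card (set ?L) = 4" by (subst distinct_card) simp_all
  have ls: "left_special n g" if "g \<in> {up, f, \<lambda>i. \<not> up i, \<lambda>i. \<not> f i}" for g
    using that left_special_up f(1) left_special_Not[OF left_special_up] left_special_Not[OF f(1)] by blast
  have ext: "b # x \<in> factors u_p (Suc n)" if x: "x \<in> set ?L" for x b
  proof -
    from x obtain g where "x = ?w g" "g \<in> {up, f, \<lambda>i. \<not> up i, \<lambda>i. \<not> f i}"
      unfolding list.set by blast
    then show ?thesis using left_special_word[OF ls] by blast
  qed
  have "factor_complexity u_p n + card (set ?L) \<le> factor_complexity u_p (Suc n)"
    by (rule factor_complexity_Suc_ge) (simp, rule ext)
  then show ?thesis unfolding card .
qed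

theorem theorem2:
  fixes n :: nat
  assumes "n \<ge> 10"
  shows "factor_complexity u_p n > 4 * n"
  using assms
proof (induction n rule: dec_induct)
  case base
  then show ?case using factor_complexity_10 by simp
next
  case (step n)
  then show ?case using factor_complexity_Suc[of n] by simp
qed

end
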